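(* Consider the problem $\min_{x\in\mathbb{R}^n}\{f(x)+g(x):h(x)=0\}$ under the assumptions stated in the context (including the descent solution oracle), and let $\{(x^k,\mu^k)\}_{k\in\mathbb{N}}$ be generated by UDD-ALM with nonlinear constraints. Let $x^*\in X$ be a limit point of $\{x^k\}_{k\in\mathbb{N}}$ that satisfies the LICQ condition, i.e., with $I(x^* )=\{l\in\{1,\dots,L\}:q_l(x^* )=0\}$, the matrix $$H^*:=[\nabla h_1(x^* ),\dots,\nabla h_m(x^* ),\{\nabla q_l(x^* )\}_{l\in I(x^* )}]\in\mathbb{R}^{n\times(m+|I(x^* )|)}$$ has full column rank. Then: 1. (Asymptotic convergence) $x^*$ is a KKT point of the problem. 2. (Iteration complexity) Let $\epsilon>0$ and define $\sigma_1:=\min\{\nu,\varrho\}$ and $\sigma_2:=c+(\rho+\varrho)\max_{x\in X}\|\nabla h(x)\|$. UDD-ALM finds an $\epsilon$-KKT point in at most $K$ iterations (that is, at least one of $x^0,\dots,x^K$ is an $\epsilon$-KKT point), where $$K\le\left\lceil\frac{\max\{1,\sigma_2\}^2\left(L_\rho(x^0,\mu^0)-f(x^* )-\tilde g(x^* )\right)}{\sigma_1\epsilon^2}\right\rceil=\mathcal{O}(\epsilon^{-2}).$$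
   Context: **Assumptions on the data.** (1) $g=\tilde g+\delta_X$, where $\delta_X$ is the $0/\infty$ indicator of a compact set $X=\{x\in\mathbb{R}^n:q_l(x)\le0,\ l=1,\dots,L\}$ with each $q_l:\mathbb{R}^n\to\mathbb{R}$ continuously differentiable, and $\tilde g:\mathbb{R}^n\to\mathbb{R}$ is continuous and convex over $X$. (2) $f:\mathbb{R}^n\to\mathbb{R}$ is continuously differentiable over $X$. (3) $h=[h_1,\dots,h_m]^\top:\mathbb{R}^n\to\mathbb{R}^m$ with each $h_j$ continuously differentiable over $X$; $\nabla h(x)=[\nabla h_1(x),\dots,\nabla h_m(x)]\in\mathbb{R}^{n\times m}$. **$\epsilon$-KKT point.** $x$ is an $\epsilon$-KKT point if there are $\mu\in\mathbb{R}^m$ and $y\in\mathbb{R}^L_+$ with $\mathrm{dist}\left(-\nabla f(x)-\nabla h(x)\mu-\sum_{l=1}^L\nabla q_l(x)y_l,\ \partial\tilde g(x)\right)\le\epsilon$, $\|h(x)\|\le\epsilon$, and $q_l(x)\le0$, $y_lq_l(x)=0$ for all $l$. A KKT point is the case $\epsilon=0$. Here $\mathrm{dist}(z,S)=\inf_{y\in S}\|y-z\|$. **Augmented Lagrangian.** $L_\rho(x,\mu)=f(x)+\tilde g(x)+\langle\mu,h(x)\rangle+\frac{\rho}{2}\|h(x)\|^2$, and $\partial_xL_\rho(x,\mu)=\nabla f(x)+\partial\tilde g(x)+\nabla h(x)(\mu+\rho h(x))$. **UDD-ALM with nonlinear constraints.** Initialize $x^0\in X$, $\mu^0\in\mathbb{R}^m$,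 $\rho\ge0$, $\varrho>0$, $c>0$. For $k=0,1,2,\dots$: obtain $x^{k+1}$ from the descent solution oracle below, applied to the subproblem $\min_{x\in X}L_\rho(x,\mu^k)+\frac{c}{2}\|x-x^k\|^2$; then set $\mu^{k+1}=\mu^k-\varrho h(x^{k+1})$. **Descent solution oracle (assumption).** There is $\nu>0$ (independent of $k$) such that, given $x^k\in X$ and $\mu^k\in\mathbb{R}^m$, one can find $x^{k+1}$ with $L_\rho(x^{k+1},\mu^k)\le L_\rho(x^k,\mu^k)-\nu\|x^{k+1}-x^k\|^2$ and for which there exists $y^{k+1}\in\mathbb{R}^L_+$ satisfying $0\in\partial_xL_\rho(x^{k+1},\mu^k)+c(x^{k+1}-x^k)+\sum_{l=1}^L\nabla q_l(x^{k+1})y_l^{k+1}$ and $q_l(x^{k+1})\le0$, $y_l^{k+1}q_l(x^{k+1})=0$ for all $l$. *)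

theory Defs
  imports "HOL-Analysis.Analysis" "HOL-Library.Landau_Symbols"
begin

definition gradient :: "('a::euclidean_space \<Rightarrow> real) \<Rightarrow> 'a \<Rightarrow> 'a"
  where "gradient f x = (THE D. GDERIV f x :> D)"

lemma GDERIV_gradient:
  fixes f :: "'a::euclidean_space \<Rightarrow> real"
  assumes "f differentiable (at x)"
  shows "GDERIV f x :> gradient f x"
proof -
  obtain f' where f': "(f has_derivative f') (at x)"
    using assms by (auto simp: differentiable_def)
  then interpret linear f' by (rule has_derivative_linear)
  define D where "D = (\<Sum>b\<in>Basis. f' b *\<^sub>R b)"
  have "f' v = v \<bullet> D" for v
  proof -
    have "f' v = f' (\<Sum>b\<in>Basis. (v \<bullet> b) *\<^sub>R b)"
      by (simp add: euclidean_representation)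
    also have "\<dots> = v \<bullet> D"
      by (simp add: sum scale D_def inner_sum_right mult.commute)
    finally show ?thesis .
  qed
  then have "f' = (\<lambda>v. v \<bullet> D)" by blast
  with f' have D: "GDERIV f x :> D" by (simp add: gderiv_def)
  have "E = D" if "GDERIV f x :> E" for E
  proof -
    have "(\<lambda>v. v \<bullet> E) = (\<lambda>v. v \<bullet> D)"
      using that D unfolding gderiv_def by (rule has_derivative_unique)
    then show ?thesis by (metis inner_commute vector_eq_ldot)
  qed
  with D show ?thesis unfolding gradient_def by (rule theI)
qed

text \<open>The derivative at a point of \<open>S\<close> is the full derivative in the ambient space, so
  that the gradient is well defined also where \<open>S\<close> has empty interior.\<close>

definition C1_over :: "'a::euclidean_space set \<Rightarrow> ('a \<Rightarrow> real) \<Rightarrow> bool"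
  where "C1_over S f \<longleftrightarrow> (\<forall>x\<in>S. f differentiable (at x)) \<and> continuous_on S (gradient f)"

text \<open>The library's \<^const>\<open>convex_on\<close> includes convexity of the set. Here the set
  may be nonconvex, and the inequality is required only for convex combinations inside it.\<close>

definition convex_over :: "'a::real_vector set \<Rightarrow> ('a \<Rightarrow> real) \<Rightarrow> bool"
  where "convex_over S g \<longleftrightarrow>
    (\<forall>x\<in>S. \<forall>y\<in>S. \<forall>t\<in>{0..1}. (1 - t) *\<^sub>R x + t *\<^sub>R y \<in> S \<longrightarrow>
       g ((1 - t) *\<^sub>R x + t *\<^sub>R y) \<le> (1 - t) * g x + t * g y)"

lemma convex_over_iff_convex_on:
  assumes "convex S"
  shows "convex_over S g \<longleftrightarrow> convex_on S g"
proof
  assume g: "convex_over S g"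
  show "convex_on S g"
  proof (rule convex_onI)
    fix t :: real and x y
    assume "0 < t" "t < 1" "x \<in> S" "y \<in> S"
    then show "g ((1 - t) *\<^sub>R x + t *\<^sub>R y) \<le> (1 - t) * g x + t * g y"
      using g convexD_alt[OF assms, of x y t] by (simp add: convex_over_def)
  qed (fact assms)
next
  assume "convex_on S g"
  then show "convex_over S g"
    unfolding convex_over_def by (auto intro: convex_onD)
qed

definition subdifferential :: "('a::real_inner \<Rightarrow> real) \<Rightarrow> 'a \<Rightarrow> 'a set"
  where "subdifferential g x = {v. \<forall>y. g y \<ge> g x + v \<bullet> (y - x)}"

text \<open>Extended-real valued, so that the distance to the empty set is \<open>\<infinity>\<close>
  (\<^const>\<open>infdist\<close> would give \<open>0\<close>).\<close>

definition dist_set :: "'a::real_normed_vector \<Rightarrow> 'a set \<Rightarrow> ereal"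
  where "dist_set z S = (INF y\<in>S. ereal (norm (y - z)))"

definition grad_mat :: "(real^'n \<Rightarrow> real^'m) \<Rightarrow> real^'n \<Rightarrow> real^'m^'n"
  where "grad_mat h x = (\<chi> i j. gradient (\<lambda>z. h z $ j) x $ i)"

definition eps_KKT ::
  "(real^'n \<Rightarrow> real) \<Rightarrow> (real^'n \<Rightarrow> real) \<Rightarrow> (real^'n \<Rightarrow> real^'m) \<Rightarrow>
   ('l::finite \<Rightarrow> real^'n \<Rightarrow> real) \<Rightarrow> real \<Rightarrow> real^'n \<Rightarrow> bool"
  where "eps_KKT f gt h q \<epsilon> x \<longleftrightarrow>
    (\<exists>(\<mu>::real^'m) (y::real^'l).
       (\<forall>l. y $ l \<ge> 0) \<and>
       dist_set (- gradient f x - grad_mat h x *v \<mu> - (\<Sum>l\<in>UNIV. y $ l *\<^sub>R gradient (q l) x))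
         (subdifferential gt x) \<le> ereal \<epsilon> \<and>
       norm (h x) \<le> \<epsilon> \<and>
       (\<forall>l. q l x \<le> 0 \<and> y $ l * q l x = 0))"

definition KKT ::
  "(real^'n \<Rightarrow> real) \<Rightarrow> (real^'n \<Rightarrow> real) \<Rightarrow> (real^'n \<Rightarrow> real^'m) \<Rightarrow>
   ('l::finite \<Rightarrow> real^'n \<Rightarrow> real) \<Rightarrow> real^'n \<Rightarrow> bool"
  where "KKT f gt h q x \<longleftrightarrow> eps_KKT f gt h q 0 x"

definition aug_lagrangian ::
  "(real^'n \<Rightarrow> real) \<Rightarrow> (real^'n \<Rightarrow> real) \<Rightarrow> (real^'n \<Rightarrow> real^'m) \<Rightarrow>
   real \<Rightarrow> real^'n \<Rightarrow> real^'m \<Rightarrow> real"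
  where "aug_lagrangian f gt h \<rho> x \<mu> = f x + gt x + \<mu> \<bullet> h x + \<rho> / 2 * (norm (h x))\<^sup>2"

definition subdiff_aug_lagrangian ::
  "(real^'n \<Rightarrow> real) \<Rightarrow> (real^'n \<Rightarrow> real) \<Rightarrow> (real^'n \<Rightarrow> real^'m) \<Rightarrow>
   real \<Rightarrow> real^'n \<Rightarrow> real^'m \<Rightarrow> (real^'n) set"
  where "subdiff_aug_lagrangian f gt h \<rho> x \<mu> =
    {gradient f x + \<xi> + grad_mat h x *v (\<mu> + \<rho> *\<^sub>R h x) | \<xi>. \<xi> \<in> subdifferential gt x}"

text \<open>\<open>x'\<close> is an admissible answer of the descent oracle (with constant \<open>\<nu>\<close>) to
  the query \<open>(x, \<mu>)\<close>.\<close>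

definition descent_oracle ::
  "(real^'n \<Rightarrow> real) \<Rightarrow> (real^'n \<Rightarrow> real) \<Rightarrow> (real^'n \<Rightarrow> real^'m) \<Rightarrow>
   ('l::finite \<Rightarrow> real^'n \<Rightarrow> real) \<Rightarrow> real \<Rightarrow> real \<Rightarrow> real \<Rightarrow>
   real^'n \<Rightarrow> real^'m \<Rightarrow> real^'n \<Rightarrow> bool"
  where "descent_oracle f gt h q \<rho> c \<nu> x \<mu> x' \<longleftrightarrow>
    aug_lagrangian f gt h \<rho> x' \<mu> \<le> aug_lagrangian f gt h \<rho> x \<mu> - \<nu> * (norm (x' - x))\<^sup>2 \<and>
    (\<exists>y::real^'l.
       (\<forall>l. y $ l \<ge> 0) \<and>
       0 \<in> {s + c *\<^sub>R (x' - x) + (\<Sum>l\<in>UNIV. y $ l *\<^sub>R gradient (q l) x') | s.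
              s \<in> subdiff_aug_lagrangian f gt h \<rho> x' \<mu>} \<and>
       (\<forall>l. q l x' \<le> 0 \<and> y $ l * q l x' = 0))"

definition UDD_ALM ::
  "(real^'n \<Rightarrow> real) \<Rightarrow> (real^'n \<Rightarrow> real) \<Rightarrow> (real^'n \<Rightarrow> real^'m) \<Rightarrow>
   ('l::finite \<Rightarrow> real^'n \<Rightarrow> real) \<Rightarrow> real \<Rightarrow> real \<Rightarrow> real \<Rightarrow> real \<Rightarrow>
   (nat \<Rightarrow> real^'n) \<Rightarrow> (nat \<Rightarrow> real^'m) \<Rightarrow> bool"
  where "UDD_ALM f gt h q \<rho> \<rho>d c \<nu> x \<mu> \<longleftrightarrow>
    (\<forall>l. q l (x 0) \<le> 0) \<and>
    (\<forall>k. descent_oracle f gt h q \<rho> c \<nu> (x k) (\<mu> k) (x (Suc k)) \<and>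
         \<mu> (Suc k) = \<mu> k - \<rho>d *\<^sub>R h (x (Suc k)))"

text \<open>The number of active indices depends on \<open>x\<close>, so the matrix of active gradients is
  given by its columns: full column rank means that the dimension of the column space equals
  the number of columns.\<close>

definition LICQ ::
  "(real^'n \<Rightarrow> real^'m) \<Rightarrow> ('l::finite \<Rightarrow> real^'n \<Rightarrow> real) \<Rightarrow> real^'n \<Rightarrow> bool"
  where "LICQ h q x \<longleftrightarrow>
    (let I = {l. q l x = 0} in
       dim (range (\<lambda>j. gradient (\<lambda>z. h z $ j) x) \<union> (\<lambda>l. gradient (q l) x) ` I)
         = CARD('m) + card I)"

end

theory Submission
  imports Defs
begin

text \<open>
  Since the dual step is a descent step, the value \<open>L\<^sub>\<rho>(x\<^sup>k, \<mu>\<^sup>k)\<close> decreases by at least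
  \<open>\<nu> \<parallel>x\<^sup>k\<^sup>+\<^sup>1 - x\<^sup>k\<parallel>\<^sup>2 + \<rho>d \<parallel>h(x\<^sup>k\<^sup>+\<^sup>1)\<parallel>\<^sup>2\<close> in each iteration. Along a subsequence converging
  to the limit point \<open>a\<close> the subgradients of \<open>gt\<close> are bounded, and LICQ then bounds the
  multipliers. So this monotone sequence of values has a convergent subsequence, hence
  converges; consequently \<open>x\<^sup>k\<^sup>+\<^sup>1 - x\<^sup>k\<close> and \<open>h(x\<^sup>k)\<close> vanish, the limit value is \<open>f a + gt a\<close>,
  and the oracle's stationarity condition passes to the limit. Telescoping the descent
  inequality gives the complexity bound, with \<open>\<mu>\<^sup>k + \<rho> h(x\<^sup>k\<^sup>+\<^sup>1)\<close> as multiplier at \<open>x\<^sup>k\<^sup>+\<^sup>1\<close>, for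
  which the stationarity residual is just \<open>c (x\<^sup>k - x\<^sup>k\<^sup>+\<^sup>1)\<close>.
\<close>

section \<open>Subdifferentials\<close>

lemma subgradient_norm_le:
  assumes subgradient: "v \<in> subdifferential g x"
    and hull: "cball x 1 \<subseteq> convex hull V" and vertices: "\<And>p. p \<in> V \<Longrightarrow> g p \<le> g x + C"
  shows "norm v \<le> C"
proof -
  have "V \<subseteq> {p. v \<bullet> p \<le> v \<bullet> x + C}"
  proof
    fix p assume "p \<in> V"
    moreover have "g x + v \<bullet> (p - x) \<le> g p" using subgradient by (simp add: subdifferential_def)
    ultimately show "p \<in> {p. v \<bullet> p \<le> v \<bullet> x + C}"
      using vertices[of p] by (simp add: inner_diff_right)
  qed
  then have halfspace: "convex hull V \<subseteq> {p. v \<bullet> p \<le> v \<bullet> x + C}"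
    by (simp add: subset_hull convex_halfspace_le)
  have "x + sgn v \<in> cball x 1" by (simp add: dist_norm norm_sgn)
  then have "x + sgn v \<in> {p. v \<bullet> p \<le> v \<bullet> x + C}" using hull halfspace by blast
  then have "v \<bullet> sgn v \<le> C" by (simp add: inner_add_right)
  moreover have "v \<bullet> sgn v = norm v"
    by (cases "v = 0") (simp_all add: sgn_div_norm dot_square_norm power2_eq_square)
  ultimately show ?thesis by simp
qed

text \<open>The function \<open>g\<close> need not be bounded above near \<open>S\<close>: only its values at the finitely many
  vertices of a box around \<open>S\<close> enter.\<close>

lemma bounded_subdifferentials:
  fixes g :: "'a::euclidean_space \<Rightarrow> real"
  assumes "bounded S" and "bdd_below (g ` S)"
  shows "bounded (\<Union>x\<in>S. subdifferential g x)"
proof -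
  obtain R where R: "\<And>x. x \<in> S \<Longrightarrow> norm x \<le> R"
    using assms(1) by (auto simp: bounded_iff)
  obtain m where m: "\<And>x. x \<in> S \<Longrightarrow> m \<le> g x"
    using assms(2) by (auto simp: bdd_below_def)
  obtain b where b: "cball (0::'a) (R + 1) \<subseteq> cbox (- b) b"
    using bounded_subset_cbox_symmetric[OF bounded_cball] by blast
  obtain V where V: "finite V" "cbox (- b) b = convex hull V"
    using closed_interval_as_convex_hull by metis
  have "norm v \<le> (\<Sum>p\<in>V. \<bar>g p\<bar>) - m" if x: "x \<in> S" and v: "v \<in> subdifferential g x" for x v
  proof (rule subgradient_norm_le[OF v])
    have "cball x 1 \<subseteq> cball 0 (R + 1)"
      using R[OF x] by (simp add: cball_subset_cball_iff add.commute)
    then show "cball x 1 \<subseteq> convex hull V" using b V(2) by simp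
    fix p assume "p \<in> V"
    then have "\<bar>g p\<bar> \<le> (\<Sum>p\<in>V. \<bar>g p\<bar>)" using V(1) by (intro member_le_sum) auto
    then show "g p \<le> g x + ((\<Sum>p\<in>V. \<bar>g p\<bar>) - m)" using m[OF x] by linarith
  qed
  then show ?thesis by (auto simp: bounded_iff)
qed

lemma subdifferential_limit:
  assumes "\<And>j. v j \<in> subdifferential g (x j)"
    and "x \<longlonglongrightarrow> a" "v \<longlonglongrightarrow> w" "(\<lambda>j. g (x j)) \<longlonglongrightarrow> g a"
  shows "w \<in> subdifferential g a"
proof -
  have "g a + w \<bullet> (y - a) \<le> g y" for y
  proof (rule LIMSEQ_le_const2)
    show "(\<lambda>j. g (x j) + v j \<bullet> (y - x j)) \<longlonglongrightarrow> g a + w \<bullet> (y - a)"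
      using assms by (intro tendsto_intros)
    show "\<exists>N. \<forall>n\<ge>N. g (x n) + v n \<bullet> (y - x n) \<le> g y"
      using assms(1) by (auto simp: subdifferential_def)
  qed
  then show ?thesis by (simp add: subdifferential_def)
qed

section \<open>Coefficients with respect to linearly independent families\<close>

lemma independent_coefficients_le:
  fixes F :: "'i \<Rightarrow> 'a::euclidean_space"
  assumes "finite J" and inj: "inj_on F J" and indep: "independent (F ` J)"
  obtains C where "C > 0" "\<And>u. (\<Sum>i\<in>J. \<bar>u i\<bar>) \<le> C * norm (\<Sum>i\<in>J. u i *\<^sub>R F i)"
proof -
  have "\<exists>g::'a \<Rightarrow> real. linear g \<and> (\<forall>i'\<in>J. g (F i') = (if i' = i then 1 else 0))"
    if "i \<in> J" for i
    using linear_independent_extend[OF indep, of "\<lambda>v. if v = F i then 1 else 0"]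
      inj_on_eq_iff[OF inj] that by simp
  then obtain g :: "'i \<Rightarrow> 'a \<Rightarrow> real" where g: "\<And>i. i \<in> J \<Longrightarrow> linear (g i)"
    and dual: "\<And>i i'. i \<in> J \<Longrightarrow> i' \<in> J \<Longrightarrow> g i (F i') = (if i' = i then 1 else 0)"
    by metis
  define C where "C = (\<Sum>i\<in>J. onorm (g i))"
  have C: "(\<Sum>i\<in>J. \<bar>u i\<bar>) \<le> C * norm (\<Sum>i\<in>J. u i *\<^sub>R F i)" for u
  proof -
    have "\<bar>u i\<bar> \<le> onorm (g i) * norm (\<Sum>i\<in>J. u i *\<^sub>R F i)" if "i \<in> J" for i
    proof -
      have "g i (\<Sum>i\<in>J. u i *\<^sub>R F i) = (\<Sum>i'\<in>J. u i' * (if i' = i then 1 else 0))"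
        using that g dual by (simp add: linear_sum linear_cmul)
      also have "\<dots> = u i" using that \<open>finite J\<close> by (simp add: if_distrib cong: if_cong)
      finally show ?thesis
        using onorm[of "g i" "\<Sum>i\<in>J. u i *\<^sub>R F i"] g[OF that]
        by (simp add: linear_conv_bounded_linear)
    qed
    then show ?thesis unfolding C_def sum_distrib_right by (rule sum_mono)
  qed
  show thesis
  proof (rule that)
    have "0 \<le> C"
      unfolding C_def using g
      by (intro sum_nonneg onorm_pos_le) (simp add: linear_conv_bounded_linear)
    then show "0 < C + 1" by simp
    show "(\<Sum>i\<in>J. \<bar>u i\<bar>) \<le> (C + 1) * norm (\<Sum>i\<in>J. u i *\<^sub>R F i)" for u
      using C[of u] by (simp add: distrib_right add_increasing2)
  qed
qed

lemma eventually_independent_coefficients_le: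
  fixes F :: "'i \<Rightarrow> 'a::euclidean_space"
  assumes "finite J" and indep: "inj_on F J" "independent (F ` J)"
    and lim: "\<And>i. i \<in> J \<Longrightarrow> (G i \<longlongrightarrow> F i) net"
  obtains C where
    "\<forall>\<^sub>F j in net. \<forall>u. (\<Sum>i\<in>J. \<bar>u i\<bar>) \<le> C * norm (\<Sum>i\<in>J. u i *\<^sub>R G i j)"
proof -
  obtain C where "C > 0" and C: "\<And>u. (\<Sum>i\<in>J. \<bar>u i\<bar>) \<le> C * norm (\<Sum>i\<in>J. u i *\<^sub>R F i)"
    using independent_coefficients_le[OF \<open>finite J\<close> indep] by blast
  have "\<forall>\<^sub>F j in net. \<forall>i\<in>J. dist (G i j) (F i) < 1 / (2 * C)"
    using \<open>C > 0\<close> by (intro eventually_ball_finite \<open>finite J\<close> ballI tendstoD lim) auto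
  then have "\<forall>\<^sub>F j in net. \<forall>u. (\<Sum>i\<in>J. \<bar>u i\<bar>) \<le> 2 * C * norm (\<Sum>i\<in>J. u i *\<^sub>R G i j)"
  proof eventually_elim
    case (elim j)
    show ?case
    proof
      fix u
      let ?P = "\<Sum>i\<in>J. u i *\<^sub>R G i j" and ?E = "\<Sum>i\<in>J. u i *\<^sub>R (G i j - F i)"
      have "norm ?E \<le> (\<Sum>i\<in>J. \<bar>u i\<bar> * (1 / (2 * C)))"
        unfolding norm_scaleR using elim
        by (intro sum_norm_le)
          (simp add: dist_norm mult_left_mono less_imp_le del: times_divide_eq_right)
      then have perturbation: "norm ?E \<le> (\<Sum>i\<in>J. \<bar>u i\<bar>) / (2 * C)"
        by (simp add: sum_divide_distrib)
      have "(\<Sum>i\<in>J. u i *\<^sub>R F i) = ?P - ?E"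
        by (simp add: sum_subtractf[symmetric] algebra_simps)
      then have "norm (\<Sum>i\<in>J. u i *\<^sub>R F i) \<le> norm ?P + (\<Sum>i\<in>J. \<bar>u i\<bar>) / (2 * C)"
        using norm_triangle_ineq4[of ?P ?E] perturbation by simp
      then have "(\<Sum>i\<in>J. \<bar>u i\<bar>) \<le> C * (norm ?P + (\<Sum>i\<in>J. \<bar>u i\<bar>) / (2 * C))"
        using C[of u] \<open>C > 0\<close> by (meson mult_left_mono order_trans less_imp_le)
      then show "(\<Sum>i\<in>J. \<bar>u i\<bar>) \<le> 2 * C * norm ?P"
        using \<open>C > 0\<close> by (simp add: field_simps)
    qed
  qed
  then show thesis by (rule that)
qed

lemma dim_image_eq_card_imp_inj_on_independent:
  fixes F :: "'i \<Rightarrow> 'a::euclidean_space"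
  assumes "finite J" and dim: "dim (F ` J) = card J"
  shows "inj_on F J" and "independent (F ` J)"
proof -
  have "dim (F ` J) \<le> card (F ` J)" by (rule dim_le_card') (use \<open>finite J\<close> in simp)
  moreover have "card (F ` J) \<le> card J" using \<open>finite J\<close> by (rule card_image_le)
  ultimately have card: "card (F ` J) = card J" using dim by simp
  then show "inj_on F J" using \<open>finite J\<close> by (intro eq_card_imp_inj_on)
  show "independent (F ` J)"
    using card_eq_dim[of "F ` J" "F ` J"] card dim \<open>finite J\<close> by (simp add: span_superset)
qed

section \<open>Sequences and asymptotics\<close>

lemma decseq_tendsto_subseq_limit:
  fixes L :: "nat \<Rightarrow> real"
  assumes "decseq L" "strict_mono k" "(\<lambda>j. L (k j)) \<longlonglongrightarrow> l"
  shows "L \<longlonglongrightarrow> l"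
proof -
  have "decseq (L \<circ> k)"
    using assms(1,2) by (auto simp: decseq_def strict_mono_less_eq)
  have "l \<le> L n" for n
  proof -
    have "l \<le> L (k n)" using decseq_ge[OF \<open>decseq (L \<circ> k)\<close>] assms(3) by (simp add: o_def)
    also have "\<dots> \<le> L n" using decseqD[OF assms(1) seq_suble[OF assms(2)]] .
    finally show ?thesis .
  qed
  then have "L \<longlonglongrightarrow> (INF n. L n)"
    using assms(1) by (intro LIMSEQ_decseq_INF bdd_belowI2)
  moreover from LIMSEQ_subseq_LIMSEQ[OF this assms(2)] have "(INF n. L n) = l"
    using assms(3) LIMSEQ_unique by (auto simp: o_def)
  ultimately show ?thesis by simp
qed

lemma tendsto_zero_if_square_le:
  fixes v :: "'b \<Rightarrow> 'a::real_normed_vector"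
  assumes "\<sigma> > 0" "\<And>k. \<sigma> * (norm (v k))\<^sup>2 \<le> d k" "(d \<longlongrightarrow> 0) F"
  shows "(v \<longlongrightarrow> 0) F"
proof -
  have "((\<lambda>k. (norm (v k))\<^sup>2) \<longlongrightarrow> 0) F"
  proof (rule tendsto_sandwich[OF _ _ tendsto_const])
    show "((\<lambda>k. d k / \<sigma>) \<longlongrightarrow> 0) F" using assms(3) by (rule tendsto_divide_zero)
  qed (use assms(1,2) in \<open>auto simp: field_simps\<close>)
  then have "((\<lambda>k. sqrt ((norm (v k))\<^sup>2)) \<longlongrightarrow> sqrt 0) F" by (rule tendsto_real_sqrt)
  then show ?thesis by (simp add: tendsto_norm_zero_iff)
qed

lemma exists_decrease_le_average:
  fixes L d :: "nat \<Rightarrow> real"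
  assumes decrease: "\<And>k. d k \<le> L k - L (Suc k)" and lower: "\<And>k. l \<le> L k" and "0 < n"
  obtains k where "k < n" "d k \<le> (L 0 - l) / n"
proof -
  have "\<exists>k<n. d k \<le> (L 0 - l) / n"
  proof (rule ccontr)
    assume "\<not> (\<exists>k<n. d k \<le> (L 0 - l) / n)"
    then have "(\<Sum>k<n. (L 0 - l) / n) < (\<Sum>k<n. d k)"
      using \<open>0 < n\<close> by (intro sum_strict_mono) (auto simp: not_le)
    also have "\<dots> \<le> (\<Sum>k<n. L k - L (Suc k))" by (intro sum_mono decrease)
    also have "\<dots> = L 0 - L n" by (rule sum_lessThan_telescope')
    also have "\<dots> \<le> L 0 - l" using lower by simp
    finally show False using \<open>0 < n\<close> by simp
  qed
  then show thesis using that by blast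
qed

lemma ceiling_bigo:
  fixes f g :: "'a \<Rightarrow> real"
  assumes "f \<in> O[F](g)" "(\<lambda>_. 1) \<in> O[F](g)"
  shows "(\<lambda>x. real_of_int \<lceil>f x\<rceil>) \<in> O[F](g)"
proof -
  have "(\<lambda>x. real_of_int \<lceil>f x\<rceil> - f x) \<in> O[F](\<lambda>_. 1)"
  proof (rule bigoI)
    have "norm (real_of_int \<lceil>f x\<rceil> - f x) \<le> 1 * norm (1::real)" for x
      unfolding real_norm_def by linarith
    then show "\<forall>\<^sub>F x in F. norm (real_of_int \<lceil>f x\<rceil> - f x) \<le> 1 * norm (1::real)"
      by (rule always_eventually[OF allI])
  qed
  from sum_in_bigo(1)[OF landau_o.big_trans[OF this assms(2)] assms(1)]
  show ?thesis by simp
qed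

lemma ceiling_bigo_inverse_square:
  fixes C \<sigma> :: real
  shows "(\<lambda>\<epsilon>. real_of_int \<lceil>C / (\<sigma> * \<epsilon>\<^sup>2)\<rceil>) \<in> O[at_right 0](\<lambda>\<epsilon>. 1 / \<epsilon>\<^sup>2)"
proof (rule ceiling_bigo)
  show "(\<lambda>\<epsilon>. C / (\<sigma> * \<epsilon>\<^sup>2)) \<in> O[at_right 0](\<lambda>\<epsilon>. 1 / \<epsilon>\<^sup>2)"
    by (rule bigoI[of _ "\<bar>C / \<sigma>\<bar>"]) (simp add: abs_mult)
  show "(\<lambda>_. 1) \<in> O[at_right 0](\<lambda>\<epsilon>::real. 1 / \<epsilon>\<^sup>2)"
  proof (rule bigoI)
    have "\<forall>\<^sub>F \<epsilon> in at_right (0::real). \<epsilon> \<in> {0<..<1}"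
      by (rule eventually_at_right_real) simp
    then show "\<forall>\<^sub>F \<epsilon> in at_right (0::real). norm (1::real) \<le> 1 * norm (1 / \<epsilon>\<^sup>2)"
      by eventually_elim (simp add: power_le_one)
  qed
qed

section \<open>Approximate KKT points\<close>

definition multiplier_gradient ::
  "(real^'n \<Rightarrow> real^'m) \<Rightarrow> ('l::finite \<Rightarrow> real^'n \<Rightarrow> real) \<Rightarrow> real^'n \<Rightarrow>
   real^'m \<Rightarrow> real^'l \<Rightarrow> real^'n"
  where "multiplier_gradient h q x \<mu> y =
    grad_mat h x *v \<mu> + (\<Sum>l\<in>UNIV. y $ l *\<^sub>R gradient (q l) x)"

definition KKT_residual ::
  "(real^'n \<Rightarrow> real) \<Rightarrow> (real^'n \<Rightarrow> real) \<Rightarrow> (real^'n \<Rightarrow> real^'m) \<Rightarrow>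
   ('l::finite \<Rightarrow> real^'n \<Rightarrow> real) \<Rightarrow> real^'n \<Rightarrow> real^'m \<Rightarrow> real^'l \<Rightarrow> real^'n \<Rightarrow> bool"
  where "KKT_residual f gt h q x \<mu> y r \<longleftrightarrow>
    (\<forall>l. y $ l \<ge> 0) \<and> (\<forall>l. q l x \<le> 0 \<and> y $ l * q l x = 0) \<and>
    r - gradient f x - multiplier_gradient h q x \<mu> y \<in> subdifferential gt x"

lemma KKT_residual_imp_eps_KKT:
  assumes res: "KKT_residual f gt h q x \<mu> y r" and "norm r \<le> \<epsilon>" "norm (h x) \<le> \<epsilon>"
  shows "eps_KKT f gt h q \<epsilon> x"
proof -
  let ?z = "- gradient f x - grad_mat h x *v \<mu> - (\<Sum>l\<in>UNIV. y $ l *\<^sub>R gradient (q l) x)"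
  have "r + ?z \<in> subdifferential gt x"
    using res by (simp add: KKT_residual_def multiplier_gradient_def algebra_simps)
  moreover have "norm (r + ?z - ?z) \<le> \<epsilon>" using \<open>norm r \<le> \<epsilon>\<close> by (simp only: add_diff_cancel_right')
  ultimately have "dist_set ?z (subdifferential gt x) \<le> ereal \<epsilon>"
    unfolding dist_set_def by (intro INF_lower2[of "r + ?z"]) auto
  then show ?thesis
    using assms unfolding eps_KKT_def KKT_residual_def by blast
qed

lemma descent_oracle_imp_KKT_residual:
  fixes q :: "'l::finite \<Rightarrow> real^'n \<Rightarrow> real"
  assumes "descent_oracle f gt h q \<rho> c \<nu> x \<mu> x'"
  shows "\<exists>y. KKT_residual f gt h q x' (\<mu> + \<rho> *\<^sub>R h x') y (c *\<^sub>R (x - x'))"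
proof -
  obtain y :: "real^'l" and \<xi> where y: "\<forall>l. y $ l \<ge> 0" "\<forall>l. q l x' \<le> 0 \<and> y $ l * q l x' = 0"
    and \<xi>: "\<xi> \<in> subdifferential gt x'"
    and stationary: "0 = gradient f x' + \<xi> + grad_mat h x' *v (\<mu> + \<rho> *\<^sub>R h x') +
      c *\<^sub>R (x' - x) + (\<Sum>l\<in>UNIV. y $ l *\<^sub>R gradient (q l) x')"
    using assms unfolding descent_oracle_def subdiff_aug_lagrangian_def by blast
  then have "\<xi> = c *\<^sub>R (x - x') - gradient f x' - multiplier_gradient h q x' (\<mu> + \<rho> *\<^sub>R h x') y"
    by (simp add: multiplier_gradient_def algebra_simps)
  then show ?thesis using y \<xi> unfolding KKT_residual_def by blast
qed

lemma grad_mat_mult: "grad_mat h x *v \<mu> = (\<Sum>j\<in>UNIV. \<mu> $ j *\<^sub>R gradient (\<lambda>z. h z $ j) x)"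
  by (simp add: vec_eq_iff grad_mat_def matrix_vector_mult_def mult.commute)

lemma onorm_grad_mat_le:
  "onorm (\<lambda>v. grad_mat h z *v v) \<le> (\<Sum>j\<in>UNIV. norm (gradient (\<lambda>z. h z $ j) z))"
proof (rule onorm_le)
  fix v
  have "norm (\<Sum>j\<in>UNIV. v $ j *\<^sub>R gradient (\<lambda>z. h z $ j) z)
      \<le> (\<Sum>j\<in>UNIV. norm (gradient (\<lambda>z. h z $ j) z) * norm v)"
    by (intro sum_norm_le)
      (simp add: mult.commute[of _ "norm v"] mult_right_mono component_le_norm_cart)
  then show "norm (grad_mat h z *v v) \<le> (\<Sum>j\<in>UNIV. norm (gradient (\<lambda>z. h z $ j) z)) * norm v"
    by (simp add: grad_mat_mult sum_distrib_right)
qed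

lemma SUP_onorm_grad_mat_nonneg:
  fixes h :: "real^'n \<Rightarrow> real^'m"
  assumes "compact S" "S \<noteq> {}" and h: "\<And>j. C1_over S (\<lambda>z. h z $ j)"
  shows "0 \<le> (SUP z\<in>S. onorm (\<lambda>v. grad_mat h z *v v))"
proof -
  have "continuous_on S (\<lambda>z. \<Sum>j\<in>UNIV. norm (gradient (\<lambda>z. h z $ j) z))"
    using h by (intro continuous_intros) (simp add: C1_over_def)
  then have "bdd_above ((\<lambda>z. \<Sum>j\<in>UNIV. norm (gradient (\<lambda>z. h z $ j) z)) ` S)"
    using \<open>compact S\<close>
    by (intro bounded_imp_bdd_above compact_imp_bounded compact_continuous_image)
  then have "bdd_above ((\<lambda>z. onorm (\<lambda>v. grad_mat h z *v v)) ` S)"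
    unfolding bdd_above_def by (blast intro: order_trans[OF onorm_grad_mat_le])
  moreover have "0 \<le> onorm (\<lambda>v. grad_mat h z *v v)" for z
    by (rule onorm_pos_le) (rule matrix_vector_mul_bounded_linear)
  ultimately show ?thesis
    using \<open>S \<noteq> {}\<close> by (metis all_not_in_conv cSUP_upper2)
qed

lemma sum_UNIV_Plus_supported:
  fixes F :: "'a::finite + 'b::finite \<Rightarrow> 'c::comm_monoid_add"
  assumes "\<And>b. b \<notin> I \<Longrightarrow> F (Inr b) = 0"
  shows "(\<Sum>i\<in>UNIV <+> I. F i) = (\<Sum>a\<in>UNIV. F (Inl a)) + (\<Sum>b\<in>UNIV. F (Inr b))"
proof -
  have "(\<Sum>b\<in>I. F (Inr b)) = (\<Sum>b\<in>UNIV. F (Inr b))"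
    using assms by (intro sum.mono_neutral_left) auto
  then show ?thesis by (simp add: sum.Plus)
qed

definition constraint_gradient ::
  "(real^'n \<Rightarrow> real^'m) \<Rightarrow> ('l::finite \<Rightarrow> real^'n \<Rightarrow> real) \<Rightarrow> 'm + 'l \<Rightarrow> real^'n \<Rightarrow> real^'n"
  where "constraint_gradient h q i x =
    (case i of Inl j \<Rightarrow> gradient (\<lambda>z. h z $ j) x | Inr l \<Rightarrow> gradient (q l) x)"

lemma LICQ_imp_inj_on_independent:
  fixes h :: "real^'n \<Rightarrow> real^'m" and q :: "'l::finite \<Rightarrow> real^'n \<Rightarrow> real"
  assumes "LICQ h q x"
  defines "J \<equiv> (UNIV::'m set) <+> {l. q l x = 0}"
  shows "inj_on (\<lambda>i. constraint_gradient h q i x) J"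
    and "independent ((\<lambda>i. constraint_gradient h q i x) ` J)"
proof -
  have "(\<lambda>i. constraint_gradient h q i x) ` J =
      range (\<lambda>j. gradient (\<lambda>z. h z $ j) x) \<union> (\<lambda>l. gradient (q l) x) ` {l. q l x = 0}"
    unfolding J_def Plus_def image_Un image_image by (simp add: constraint_gradient_def)
  then have "dim ((\<lambda>i. constraint_gradient h q i x) ` J) = card J"
    using assms(1) by (simp add: LICQ_def Let_def J_def card_Plus)
  then show "inj_on (\<lambda>i. constraint_gradient h q i x) J"
    and "independent ((\<lambda>i. constraint_gradient h q i x) ` J)"
    by (intro dim_image_eq_card_imp_inj_on_independent; simp)+
qed

lemma C1_over_tendsto:
  assumes "C1_over S f" "a \<in> S" "\<forall>\<^sub>F j in F. x j \<in> S" "(x \<longlongrightarrow> a) F"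
  shows "((\<lambda>j. f (x j)) \<longlongrightarrow> f a) F" "((\<lambda>j. gradient f (x j)) \<longlongrightarrow> gradient f a) F"
proof -
  have "isCont f a"
    using assms(1,2) by (auto simp: C1_over_def intro: differentiable_imp_continuous_within)
  then show "((\<lambda>j. f (x j)) \<longlongrightarrow> f a) F"
    using assms(4) by (rule isCont_tendsto_compose)
  show "((\<lambda>j. gradient f (x j)) \<longlongrightarrow> gradient f a) F"
    using assms by (intro continuous_on_tendsto_compose[of S "gradient f"]) (auto simp: C1_over_def)
qed

locale regular_problem =
  fixes f gt :: "real^'n \<Rightarrow> real"
    and h :: "real^'n \<Rightarrow> real^'m"
    and q :: "'l::finite \<Rightarrow> real^'n \<Rightarrow> real"
    and X :: "(real^'n) set"
  assumes feasible_set: "X = {z. \<forall>l. q l z \<le> 0}"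
    and q_C1: "C1_over X (q l)"
    and gt_continuous: "continuous_on X gt"
    and f_C1: "C1_over X f"
    and h_C1: "C1_over X (\<lambda>z. h z $ j)"
begin

lemma KKT_residual_feasible: "KKT_residual f gt h q x \<mu> y r \<Longrightarrow> x \<in> X"
  by (simp add: KKT_residual_def feasible_set)

lemma
  assumes "a \<in> X" "\<forall>\<^sub>F j in F. x j \<in> X" "(x \<longlongrightarrow> a) F"
  shows f_tendsto: "((\<lambda>j. f (x j)) \<longlongrightarrow> f a) F"
    and gradient_f_tendsto: "((\<lambda>j. gradient f (x j)) \<longlongrightarrow> gradient f a) F"
    and q_tendsto: "((\<lambda>j. q l (x j)) \<longlongrightarrow> q l a) F"
    and gt_tendsto: "((\<lambda>j. gt (x j)) \<longlongrightarrow> gt a) F"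
    and h_tendsto: "((\<lambda>j. h (x j)) \<longlongrightarrow> h a) F"
    and constraint_gradient_tendsto:
      "((\<lambda>j. constraint_gradient h q i (x j)) \<longlongrightarrow> constraint_gradient h q i a) F"
proof -
  show "((\<lambda>j. f (x j)) \<longlongrightarrow> f a) F" "((\<lambda>j. gradient f (x j)) \<longlongrightarrow> gradient f a) F"
    by (rule C1_over_tendsto[OF f_C1 assms])+
  show "((\<lambda>j. q l (x j)) \<longlongrightarrow> q l a) F" by (rule C1_over_tendsto[OF q_C1 assms])
  show "((\<lambda>j. gt (x j)) \<longlongrightarrow> gt a) F"
    by (rule continuous_on_tendsto_compose[OF gt_continuous assms(3,1,2)])
  show "((\<lambda>j. h (x j)) \<longlongrightarrow> h a) F"
    by (intro vec_tendstoI C1_over_tendsto(1)[OF h_C1 assms])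
  show "((\<lambda>j. constraint_gradient h q i (x j)) \<longlongrightarrow> constraint_gradient h q i a) F"
    using C1_over_tendsto(2)[OF h_C1 assms] C1_over_tendsto(2)[OF q_C1 assms]
    by (cases i) (simp_all add: constraint_gradient_def)
qed

lemma multiplier_gradient_tendsto:
  assumes "a \<in> X" "\<forall>\<^sub>F j in F. x j \<in> X" "(x \<longlongrightarrow> a) F" and "(\<mu> \<longlongrightarrow> \<mu>') F" "(y \<longlongrightarrow> y') F"
  shows "((\<lambda>j. multiplier_gradient h q (x j) (\<mu> j) (y j)) \<longlongrightarrow> multiplier_gradient h q a \<mu>' y') F"
proof -
  have "((\<lambda>j. gradient (\<lambda>z. h z $ i) (x j)) \<longlongrightarrow> gradient (\<lambda>z. h z $ i) a) F" for i
    by (rule C1_over_tendsto[OF h_C1 assms(1-3)])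
  moreover have "((\<lambda>j. gradient (q l) (x j)) \<longlongrightarrow> gradient (q l) a) F" for l
    by (rule C1_over_tendsto[OF q_C1 assms(1-3)])
  ultimately show ?thesis
    unfolding multiplier_gradient_def grad_mat_mult by (intro tendsto_intros assms(4,5))
qed

lemma eventually_active_imp_active:
  assumes "a \<in> X" "\<forall>\<^sub>F j in F. x j \<in> X" "(x \<longlongrightarrow> a) F"
  shows "\<forall>\<^sub>F j in F. \<forall>l. q l (x j) = 0 \<longrightarrow> q l a = 0"
proof (intro eventually_all_finite)
  fix l
  show "\<forall>\<^sub>F j in F. q l (x j) = 0 \<longrightarrow> q l a = 0"
    using q_tendsto[OF assms]
    by (cases "q l a = 0") (auto dest: tendsto_imp_eventually_ne elim: eventually_mono)
qed

lemma multiplier_norms_le_near_LICQ_point: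
  assumes "LICQ h q a" and lim: "a \<in> X" "\<forall>\<^sub>F j in F. x j \<in> X" "(x \<longlongrightarrow> a) F"
  obtains C where "\<forall>\<^sub>F j in F. \<forall>\<mu> y. (\<forall>l. y $ l * q l (x j) = 0) \<longrightarrow>
    norm \<mu> + norm y \<le> C * norm (multiplier_gradient h q (x j) \<mu> y)"
proof -
  let ?J = "(UNIV::'m set) <+> {l. q l a = 0}"
  obtain C where "\<forall>\<^sub>F j in F. \<forall>u. (\<Sum>i\<in>?J. \<bar>u i\<bar>)
      \<le> C * norm (\<Sum>i\<in>?J. u i *\<^sub>R constraint_gradient h q i (x j))"
    using eventually_independent_coefficients_le[OF _ LICQ_imp_inj_on_independent[OF \<open>LICQ h q a\<close>]
        constraint_gradient_tendsto[OF lim]] by auto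
  with eventually_active_imp_active[OF lim]
  have "\<forall>\<^sub>F j in F. \<forall>\<mu> y. (\<forall>l. y $ l * q l (x j) = 0) \<longrightarrow>
    norm \<mu> + norm y \<le> C * norm (multiplier_gradient h q (x j) \<mu> y)"
  proof eventually_elim
    case (elim j)
    show ?case
    proof (intro allI impI)
      fix \<mu> :: "real^'m" and y :: "real^'l"
      assume "\<forall>l. y $ l * q l (x j) = 0"
      then have inactive: "y $ l = 0" if "q l a \<noteq> 0" for l using elim(1) that by auto
      define u where "u = case_sum (($) \<mu>) (($) y)"
      have "norm \<mu> + norm y \<le> (\<Sum>i\<in>UNIV. \<bar>\<mu> $ i\<bar>) + (\<Sum>l\<in>UNIV. \<bar>y $ l\<bar>)"
        by (intro add_mono norm_le_l1_cart)
      also have "\<dots> = (\<Sum>i\<in>?J. \<bar>u i\<bar>)"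
        using inactive by (subst sum_UNIV_Plus_supported) (simp_all add: u_def)
      also have "\<dots> \<le> C * norm (\<Sum>i\<in>?J. u i *\<^sub>R constraint_gradient h q i (x j))"
        using elim(2) by blast
      also have "(\<Sum>i\<in>?J. u i *\<^sub>R constraint_gradient h q i (x j)) =
          multiplier_gradient h q (x j) \<mu> y"
        using inactive by (subst sum_UNIV_Plus_supported)
          (simp_all add: u_def constraint_gradient_def multiplier_gradient_def grad_mat_mult)
      finally show "norm \<mu> + norm y \<le> C * norm (multiplier_gradient h q (x j) \<mu> y)" .
    qed
  qed
  then show thesis by (rule that)
qed

lemma KKT_residual_multiplier_gradient_Bseq:
  assumes "a \<in> X" "x \<longlonglongrightarrow> a" "Bseq r"
    and res: "\<And>j. KKT_residual f gt h q (x j) (\<mu> j) (y j) (r j)"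
  shows "Bseq (\<lambda>j. multiplier_gradient h q (x j) (\<mu> j) (y j))"
proof -
  define \<xi> where "\<xi> j = r j - gradient f (x j) - multiplier_gradient h q (x j) (\<mu> j) (y j)" for j
  have lim: "a \<in> X" "\<forall>\<^sub>F j in sequentially. x j \<in> X" "x \<longlonglongrightarrow> a"
    using assms KKT_residual_feasible[OF res] by auto
  have "bounded (gt ` range x)"
    using convergent_imp_bounded[OF gt_tendsto[OF lim]] by (simp add: image_image)
  then have "bounded (\<Union>z\<in>range x. subdifferential gt z)"
    using \<open>x \<longlonglongrightarrow> a\<close>
    by (intro bounded_subdifferentials bounded_imp_bdd_below convergent_imp_bounded)
  moreover have "\<xi> j \<in> subdifferential gt (x j)" for j
    using res by (simp add: KKT_residual_def \<xi>_def)
  ultimately have "bounded (range \<xi>)" by (auto elim!: bounded_subset)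
  moreover have "bounded (range (\<lambda>j. gradient f (x j)))"
    using gradient_f_tendsto[OF lim] by (rule convergent_imp_bounded)
  ultimately have "Bseq (\<lambda>j. r j - gradient f (x j) - \<xi> j)"
    using \<open>Bseq r\<close> by (simp add: Bseq_eq_bounded bounded_minus_comp)
  then show ?thesis by (simp add: \<xi>_def)
qed

lemma KKT_residual_multipliers_Bseq:
  assumes "LICQ h q a" and "a \<in> X" "x \<longlonglongrightarrow> a" "Bseq r"
    and res: "\<And>j. KKT_residual f gt h q (x j) (\<mu> j) (y j) (r j)"
  shows "Bseq \<mu>" and "Bseq y"
proof -
  have lim: "a \<in> X" "\<forall>\<^sub>F j in sequentially. x j \<in> X" "x \<longlonglongrightarrow> a"
    using assms KKT_residual_feasible[OF res] by auto
  obtain B where B: "\<And>j. norm (multiplier_gradient h q (x j) (\<mu> j) (y j)) \<le> B"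
    using KKT_residual_multiplier_gradient_Bseq[OF assms(2-5)] by (auto simp: Bseq_def)
  obtain C where "\<forall>\<^sub>F j in sequentially. \<forall>\<mu> y. (\<forall>l. y $ l * q l (x j) = 0) \<longrightarrow>
    norm \<mu> + norm y \<le> C * norm (multiplier_gradient h q (x j) \<mu> y)"
    using multiplier_norms_le_near_LICQ_point[OF \<open>LICQ h q a\<close> lim] by blast
  then have "\<forall>\<^sub>F j in sequentially. norm (\<mu> j) + norm (y j) \<le> \<bar>C\<bar> * B"
  proof eventually_elim
    case (elim j)
    then have "norm (\<mu> j) + norm (y j) \<le> C * norm (multiplier_gradient h q (x j) (\<mu> j) (y j))"
      using res by (simp add: KKT_residual_def)
    also have "\<dots> \<le> \<bar>C\<bar> * B" using B by (intro mult_mono) auto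
    finally show ?case .
  qed
  then have "\<forall>\<^sub>F j in sequentially. norm (\<mu> j) \<le> \<bar>C\<bar> * B"
    and "\<forall>\<^sub>F j in sequentially. norm (y j) \<le> \<bar>C\<bar> * B"
    by (auto elim!: eventually_mono intro: order_trans[rotated])
  then show "Bseq \<mu>" and "Bseq y" by (auto intro: BfunI)
qed

lemma KKT_residual_limit:
  assumes res: "\<And>j. KKT_residual f gt h q (x j) (\<mu> j) (y j) (r j)"
    and "a \<in> X" "x \<longlonglongrightarrow> a" "\<mu> \<longlonglongrightarrow> \<mu>'" "y \<longlonglongrightarrow> y'" "r \<longlonglongrightarrow> r'"
  shows "KKT_residual f gt h q a \<mu>' y' r'"
proof -
  have lim: "a \<in> X" "\<forall>\<^sub>F j in sequentially. x j \<in> X" "x \<longlonglongrightarrow> a"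
    using assms KKT_residual_feasible[OF res] by auto
  have "y' $ l \<ge> 0" for l
    using res by (intro LIMSEQ_le_const[OF tendsto_vec_nth[OF \<open>y \<longlonglongrightarrow> y'\<close>]])
      (auto simp: KKT_residual_def)
  moreover have "y' $ l * q l a = 0" for l
  proof -
    have "(\<lambda>j. y j $ l * q l (x j)) \<longlonglongrightarrow> y' $ l * q l a"
      by (intro tendsto_intros \<open>y \<longlonglongrightarrow> y'\<close> q_tendsto lim)
    moreover have "y j $ l * q l (x j) = 0" for j using res by (simp add: KKT_residual_def)
    ultimately show ?thesis by (simp only: LIMSEQ_const_iff)
  qed
  moreover have "r' - gradient f a - multiplier_gradient h q a \<mu>' y' \<in> subdifferential gt a"
  proof (rule subdifferential_limit[OF _ \<open>x \<longlonglongrightarrow> a\<close> _ gt_tendsto[OF lim]])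
    show "r j - gradient f (x j) - multiplier_gradient h q (x j) (\<mu> j) (y j)
        \<in> subdifferential gt (x j)" for j
      using res by (simp add: KKT_residual_def)
    show "(\<lambda>j. r j - gradient f (x j) - multiplier_gradient h q (x j) (\<mu> j) (y j))
        \<longlonglongrightarrow> r' - gradient f a - multiplier_gradient h q a \<mu>' y'"
      by (intro tendsto_diff gradient_f_tendsto multiplier_gradient_tendsto lim assms(4-6))
  qed
  ultimately show ?thesis
    using \<open>a \<in> X\<close> by (simp add: KKT_residual_def feasible_set)
qed

end

section \<open>The UDD-ALM iteration\<close>

locale UDD_ALM_run =
  fixes f gt :: "real^'n \<Rightarrow> real"
    and h :: "real^'n \<Rightarrow> real^'m"
    and q :: "'l::finite \<Rightarrow> real^'n \<Rightarrow> real"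
    and \<rho> \<rho>d c \<nu> :: real
    and x :: "nat \<Rightarrow> real^'n" and \<mu> :: "nat \<Rightarrow> real^'m"
  assumes generated: "UDD_ALM f gt h q \<rho> \<rho>d c \<nu> x \<mu>"
    and \<rho>d_pos: "\<rho>d > 0" and \<nu>_pos: "\<nu> > 0"
begin

definition merit :: "nat \<Rightarrow> real"
  where "merit k = aug_lagrangian f gt h \<rho> (x k) (\<mu> k)"

definition decrease :: "nat \<Rightarrow> real"
  where "decrease k = \<nu> * (norm (x (Suc k) - x k))\<^sup>2 + \<rho>d * (norm (h (x (Suc k))))\<^sup>2"

definition eq_multiplier :: "nat \<Rightarrow> real^'m"
  where "eq_multiplier k = \<mu> k + \<rho> *\<^sub>R h (x (Suc k))"

definition ineq_multiplier :: "nat \<Rightarrow> real^'l"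
  where "ineq_multiplier k = (SOME y. KKT_residual f gt h q (x (Suc k)) (eq_multiplier k) y
    (c *\<^sub>R (x k - x (Suc k))))"

lemma feasible: "q l (x k) \<le> 0"
  using generated by (cases k) (auto simp: UDD_ALM_def descent_oracle_def)

lemma multiplier_update: "\<mu> (Suc k) = \<mu> k - \<rho>d *\<^sub>R h (x (Suc k))"
  using generated by (simp add: UDD_ALM_def)

lemma iterate_KKT_residual:
  "KKT_residual f gt h q (x (Suc k)) (eq_multiplier k) (ineq_multiplier k)
    (c *\<^sub>R (x k - x (Suc k)))"
proof -
  have "descent_oracle f gt h q \<rho> c \<nu> (x k) (\<mu> k) (x (Suc k))"
    using generated by (simp add: UDD_ALM_def)
  then show ?thesis
    unfolding ineq_multiplier_def eq_multiplier_def
    by (rule someI_ex[OF descent_oracle_imp_KKT_residual])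
qed

lemma decrease_le: "decrease k \<le> merit k - merit (Suc k)"
proof -
  have "aug_lagrangian f gt h \<rho> (x (Suc k)) (\<mu> k) \<le> merit k - \<nu> * (norm (x (Suc k) - x k))\<^sup>2"
    using generated by (simp add: UDD_ALM_def descent_oracle_def merit_def)
  moreover have "merit (Suc k) =
      aug_lagrangian f gt h \<rho> (x (Suc k)) (\<mu> k) - \<rho>d * (norm (h (x (Suc k))))\<^sup>2"
    by (simp add: merit_def aug_lagrangian_def multiplier_update inner_diff_left
        power2_norm_eq_inner)
  ultimately show ?thesis by (simp add: decrease_def)
qed

lemma step_square_le_decrease: "\<nu> * (norm (x (Suc k) - x k))\<^sup>2 \<le> decrease k"
  and constraint_square_le_decrease: "\<rho>d * (norm (h (x (Suc k))))\<^sup>2 \<le> decrease k"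
  using \<nu>_pos \<rho>d_pos by (simp_all add: decrease_def)

lemma decrease_nonneg: "0 \<le> decrease k"
  using \<nu>_pos \<rho>d_pos by (simp add: decrease_def)

lemma decseq_merit: "decseq merit"
proof (rule decseq_SucI)
  show "merit (Suc k) \<le> merit k" for k using decrease_le[of k] decrease_nonneg[of k] by linarith
qed

lemma
  assumes "merit \<longlonglongrightarrow> l"
  shows steps_tendsto_zero: "(\<lambda>k. x (Suc k) - x k) \<longlonglongrightarrow> 0"
    and constraints_tendsto_zero: "(\<lambda>k. h (x (Suc k))) \<longlonglongrightarrow> 0"
proof -
  have "(\<lambda>k. merit k - merit (Suc k)) \<longlonglongrightarrow> 0"
    using tendsto_diff[OF assms LIMSEQ_Suc[OF assms]] by simp
  then have "decrease \<longlonglongrightarrow> 0"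
    by (rule tendsto_sandwich[OF _ _ tendsto_const, rotated 2])
      (auto simp: decrease_nonneg decrease_le)
  then show "(\<lambda>k. x (Suc k) - x k) \<longlonglongrightarrow> 0" "(\<lambda>k. h (x (Suc k))) \<longlonglongrightarrow> 0"
    by (rule tendsto_zero_if_square_le[OF \<nu>_pos step_square_le_decrease]
        tendsto_zero_if_square_le[OF \<rho>d_pos constraint_square_le_decrease])+
qed

lemma small_decrease_imp_eps_KKT:
  assumes M: "1 \<le> M" "\<bar>c\<bar> \<le> M" and "0 \<le> \<epsilon>" and small: "M\<^sup>2 * decrease k \<le> min \<nu> \<rho>d * \<epsilon>\<^sup>2"
  shows "eps_KKT f gt h q \<epsilon> (x (Suc k))"
proof -
  have scaled_le: "M * t \<le> \<epsilon>" if "\<sigma> * t\<^sup>2 \<le> decrease k" "min \<nu> \<rho>d \<le> \<sigma>" for \<sigma> t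
  proof -
    have "min \<nu> \<rho>d * t\<^sup>2 \<le> decrease k"
      using mult_right_mono[OF that(2), of "t\<^sup>2"] that(1) by simp
    then have "M\<^sup>2 * (min \<nu> \<rho>d * t\<^sup>2) \<le> min \<nu> \<rho>d * \<epsilon>\<^sup>2"
      using small by (meson mult_left_mono order_trans zero_le_power2)
    then have "min \<nu> \<rho>d * (M * t)\<^sup>2 \<le> min \<nu> \<rho>d * \<epsilon>\<^sup>2"
      by (simp add: power_mult_distrib mult.left_commute)
    then have "(M * t)\<^sup>2 \<le> \<epsilon>\<^sup>2" using \<nu>_pos \<rho>d_pos by (simp add: min_def split: if_splits)
    then show ?thesis using \<open>0 \<le> \<epsilon>\<close> by (rule power2_le_imp_le)
  qed
  show ?thesis
  proof (rule KKT_residual_imp_eps_KKT[OF iterate_KKT_residual])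
    have "norm (c *\<^sub>R (x k - x (Suc k))) \<le> M * norm (x (Suc k) - x k)"
      using M(2) by (simp add: norm_minus_commute mult_right_mono)
    also have "\<dots> \<le> \<epsilon>" by (rule scaled_le[OF step_square_le_decrease]) simp
    finally show "norm (c *\<^sub>R (x k - x (Suc k))) \<le> \<epsilon>" .
    have "norm (h (x (Suc k))) \<le> M * norm (h (x (Suc k)))"
      using mult_right_mono[OF M(1), of "norm (h (x (Suc k)))"] by simp
    also have "\<dots> \<le> \<epsilon>" by (rule scaled_le[OF constraint_square_le_decrease]) simp
    finally show "norm (h (x (Suc k))) \<le> \<epsilon>" .
  qed
qed

lemma eps_KKT_start_if_merit_minimal:
  assumes "merit 0 \<le> merit 1" "0 \<le> \<epsilon>"
  shows "eps_KKT f gt h q \<epsilon> (x 0)"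
proof -
  have no_decrease: "decrease 0 = 0"
    using decrease_le[of 0] decrease_nonneg[of 0] assms(1) by simp
  then have "x (Suc 0) = x 0"
    using step_square_le_decrease[of 0] \<nu>_pos by (simp add: mult_le_0_iff)
  moreover have "eps_KKT f gt h q \<epsilon> (x (Suc 0))"
    by (rule small_decrease_imp_eps_KKT[of "max 1 \<bar>c\<bar>"])
      (use no_decrease assms(2) \<nu>_pos \<rho>d_pos in auto)
  ultimately show ?thesis by simp
qed

lemma eps_KKT_iteration_bound:
  assumes lower: "\<And>k. l \<le> merit k" and M: "1 \<le> M" "\<bar>c\<bar> \<le> M" and "0 < \<epsilon>"
  shows "\<exists>K::nat. int K \<le> \<lceil>M\<^sup>2 * (merit 0 - l) / (min \<nu> \<rho>d * \<epsilon>\<^sup>2)\<rceil> \<and>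
    (\<exists>k\<le>K. eps_KKT f gt h q \<epsilon> (x k))"
proof -
  define b where "b = M\<^sup>2 * (merit 0 - l) / (min \<nu> \<rho>d * \<epsilon>\<^sup>2)"
  have "0 < min \<nu> \<rho>d" using \<nu>_pos \<rho>d_pos by simp
  then have "0 \<le> b" using lower[of 0] by (simp add: b_def)
  have "\<exists>k\<le>nat \<lceil>b\<rceil>. eps_KKT f gt h q \<epsilon> (x k)"
  proof (cases "merit 0 \<le> l")
    case True
    \<comment> \<open>The bound is zero, so \<open>x 0\<close> itself has to be approximately stationary.\<close>
    then have "merit 0 \<le> merit 1" using lower[of 1] by simp
    then show ?thesis using eps_KKT_start_if_merit_minimal \<open>0 < \<epsilon>\<close> by (meson le0 less_imp_le)
  next
    case False
    then have "0 < b" using \<open>0 < min \<nu> \<rho>d\<close> \<open>0 < \<epsilon>\<close> M(1) by (simp add: b_def)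
    then have "0 < nat \<lceil>b\<rceil>" by simp
    then obtain k where "k < nat \<lceil>b\<rceil>" and small: "decrease k \<le> (merit 0 - l) / nat \<lceil>b\<rceil>"
      using exists_decrease_le_average[where L = merit, OF decrease_le lower] by blast
    note small
    also have "(merit 0 - l) / nat \<lceil>b\<rceil> \<le> (merit 0 - l) / b"
      using \<open>0 < b\<close> lower[of 0] by (intro divide_left_mono) (auto intro: real_nat_ceiling_ge)
    finally have "M\<^sup>2 * decrease k \<le> M\<^sup>2 * ((merit 0 - l) / b)"
      by (rule mult_left_mono) simp
    also have "\<dots> = min \<nu> \<rho>d * \<epsilon>\<^sup>2" using \<open>0 < b\<close> by (auto simp: b_def)
    finally have "eps_KKT f gt h q \<epsilon> (x (Suc k))"
      using \<open>0 < \<epsilon>\<close> by (intro small_decrease_imp_eps_KKT[OF M]) auto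
    then show ?thesis using \<open>k < nat \<lceil>b\<rceil>\<close> Suc_leI by blast
  qed
  then show ?thesis
    using \<open>0 \<le> b\<close> unfolding b_def[symmetric] by (intro exI[of _ "nat \<lceil>b\<rceil>"]) simp
qed

end

section \<open>Limit points of the iteration\<close>

locale UDD_ALM_LICQ_limit_point =
  regular_problem f gt h q X + UDD_ALM_run f gt h q \<rho> \<rho>d c \<nu> x \<mu>
  for f gt :: "real^'n \<Rightarrow> real"
    and h :: "real^'n \<Rightarrow> real^'m"
    and q :: "'l::finite \<Rightarrow> real^'n \<Rightarrow> real"
    and X \<rho> \<rho>d c \<nu> x \<mu> +
  fixes a :: "real^'n"
  assumes compact_X: "compact X"
    and limit_point: "\<exists>r. strict_mono r \<and> (x \<circ> r) \<longlonglongrightarrow> a"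
    and licq: "LICQ h q a"
begin

lemma iterate_in_X: "x k \<in> X"
  using feasible by (simp add: feasible_set)

lemma limit_point_in_X: "a \<in> X"
proof -
  obtain r where "(x \<circ> r) \<longlonglongrightarrow> a" using limit_point by blast
  then show ?thesis
    by (rule closed_sequentially[OF compact_imp_closed[OF compact_X], rotated])
      (simp add: iterate_in_X)
qed

lemma shifted_limit_point:
  obtains s where "strict_mono s" "(\<lambda>j. x (Suc (s j))) \<longlonglongrightarrow> a"
proof -
  obtain r where r: "strict_mono r" "(x \<circ> r) \<longlonglongrightarrow> a" using limit_point by blast
  define s where "s j = r (Suc j) - 1" for j
  have Suc_s: "Suc (s j) = r (Suc j)" for j
    using seq_suble[OF r(1), of "Suc j"] by (simp add: s_def)
  have "strict_mono s"
    using strict_monoD[OF r(1)] by (intro strict_monoI) (metis Suc_less_eq Suc_s)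
  moreover have "(\<lambda>j. x (Suc (s j))) \<longlonglongrightarrow> a"
    using LIMSEQ_Suc[OF r(2)] by (simp add: Suc_s)
  ultimately show thesis by (rule that)
qed

lemma convergent_multiplier_subsequence:
  obtains k m y where "strict_mono k" "(\<lambda>j. x (Suc (k j))) \<longlonglongrightarrow> a"
    "(\<lambda>j. eq_multiplier (k j)) \<longlonglongrightarrow> m" "(\<lambda>j. ineq_multiplier (k j)) \<longlonglongrightarrow> y"
proof -
  obtain s where s: "strict_mono s" "(\<lambda>j. x (Suc (s j))) \<longlonglongrightarrow> a" by (rule shifted_limit_point)
  have "bounded (range x)"
    using compact_imp_bounded[OF compact_X] by (rule bounded_subset) (auto simp: iterate_in_X)
  then have "bounded (range (\<lambda>j. x (s j)))" "bounded (range (\<lambda>j. x (Suc (s j))))"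
    by (auto elim!: bounded_subset)
  then have "Bseq (\<lambda>j. c *\<^sub>R (x (s j) - x (Suc (s j))))"
    unfolding Bseq_eq_bounded by (intro bounded_scaleR_comp bounded_minus_comp)
  from KKT_residual_multipliers_Bseq[OF licq limit_point_in_X s(2) this iterate_KKT_residual]
  have "bounded (range (\<lambda>j. (eq_multiplier (s j), ineq_multiplier (s j))))"
    by (intro bounded_subset[OF bounded_Times, of "range (\<lambda>j. eq_multiplier (s j))"
          "range (\<lambda>j. ineq_multiplier (s j))"])
      (auto simp: Bseq_eq_bounded)
  then obtain z t where t: "strict_mono t"
    "((\<lambda>j. (eq_multiplier (s j), ineq_multiplier (s j))) \<circ> t) \<longlonglongrightarrow> z"
    using bounded_imp_convergent_subsequence by blast
  show thesis
  proof (rule that)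
    show "strict_mono (s \<circ> t)" using s(1) t(1) by (rule strict_mono_o)
    show "(\<lambda>j. x (Suc ((s \<circ> t) j))) \<longlonglongrightarrow> a"
      using LIMSEQ_subseq_LIMSEQ[OF s(2) t(1)] by (simp add: o_def)
    show "(\<lambda>j. eq_multiplier ((s \<circ> t) j)) \<longlonglongrightarrow> fst z"
      "(\<lambda>j. ineq_multiplier ((s \<circ> t) j)) \<longlonglongrightarrow> snd z"
      using tendsto_fst[OF t(2)] tendsto_snd[OF t(2)] by (simp_all add: o_def)
  qed
qed

lemma merit_tendsto_aug_lagrangian: "\<exists>m. merit \<longlonglongrightarrow> aug_lagrangian f gt h \<rho> a m"
proof -
  obtain k m where k: "strict_mono k" "(\<lambda>j. x (Suc (k j))) \<longlonglongrightarrow> a"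
    and m: "(\<lambda>j. eq_multiplier (k j)) \<longlonglongrightarrow> m"
    using convergent_multiplier_subsequence by blast
  have lim: "a \<in> X" "\<forall>\<^sub>F j in sequentially. x (Suc (k j)) \<in> X" "(\<lambda>j. x (Suc (k j))) \<longlonglongrightarrow> a"
    using limit_point_in_X iterate_in_X k(2) by auto
  have "\<mu> (Suc k) = eq_multiplier k - (\<rho> + \<rho>d) *\<^sub>R h (x (Suc k))" for k
    by (simp add: eq_multiplier_def multiplier_update algebra_simps)
  then have \<mu>_lim: "(\<lambda>j. \<mu> (Suc (k j))) \<longlonglongrightarrow> m - (\<rho> + \<rho>d) *\<^sub>R h a"
    by (simp only:) (intro tendsto_intros m h_tendsto lim)
  have "(\<lambda>j. merit (Suc (k j))) \<longlonglongrightarrow> aug_lagrangian f gt h \<rho> a (m - (\<rho> + \<rho>d) *\<^sub>R h a)"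
    unfolding merit_def aug_lagrangian_def
    by (intro tendsto_intros f_tendsto gt_tendsto h_tendsto lim \<mu>_lim)
  moreover have "strict_mono (\<lambda>j. Suc (k j))" using k(1) by (simp add: strict_mono_def)
  ultimately show ?thesis using decseq_tendsto_subseq_limit[OF decseq_merit] by blast
qed

lemma h_limit_point: "h a = 0"
proof -
  obtain s where s: "strict_mono s" "(\<lambda>j. x (Suc (s j))) \<longlonglongrightarrow> a" by (rule shifted_limit_point)
  have "(\<lambda>k. h (x (Suc k))) \<longlonglongrightarrow> 0"
    using merit_tendsto_aug_lagrangian constraints_tendsto_zero by blast
  from LIMSEQ_subseq_LIMSEQ[OF this s(1)] have "(\<lambda>j. h (x (Suc (s j)))) \<longlonglongrightarrow> 0"
    by (simp add: o_def)
  moreover have "(\<lambda>j. h (x (Suc (s j)))) \<longlonglongrightarrow> h a"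
    using limit_point_in_X iterate_in_X s(2) by (intro h_tendsto) auto
  ultimately show ?thesis using LIMSEQ_unique by blast
qed

lemma objective_limit_point_le_merit: "f a + gt a \<le> merit k"
proof -
  obtain m where "merit \<longlonglongrightarrow> aug_lagrangian f gt h \<rho> a m"
    using merit_tendsto_aug_lagrangian by blast
  then show ?thesis
    using decseq_ge[OF decseq_merit] by (simp add: aug_lagrangian_def h_limit_point)
qed

theorem KKT_limit_point: "KKT f gt h q a"
proof -
  obtain k m y where k: "strict_mono k" "(\<lambda>j. x (Suc (k j))) \<longlonglongrightarrow> a"
    and multipliers: "(\<lambda>j. eq_multiplier (k j)) \<longlonglongrightarrow> m" "(\<lambda>j. ineq_multiplier (k j)) \<longlonglongrightarrow> y"
    by (rule convergent_multiplier_subsequence)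
  have "(\<lambda>k. x (Suc k) - x k) \<longlonglongrightarrow> 0"
    using merit_tendsto_aug_lagrangian steps_tendsto_zero by blast
  from LIMSEQ_subseq_LIMSEQ[OF tendsto_minus[OF this] k(1)]
  have "(\<lambda>j. c *\<^sub>R (x (k j) - x (Suc (k j)))) \<longlonglongrightarrow> c *\<^sub>R 0"
    by (intro tendsto_scaleR tendsto_const) (simp add: o_def)
  then have "KKT_residual f gt h q a m y (c *\<^sub>R 0)"
    by (rule KKT_residual_limit[OF iterate_KKT_residual[of "k j" for j] limit_point_in_X
          k(2) multipliers])
  then show ?thesis
    unfolding KKT_def by (rule KKT_residual_imp_eps_KKT) (simp_all add: h_limit_point)
qed

end

theorem theoremB6:
  fixes f gt :: "real^'n \<Rightarrow> real"
    and h :: "real^'n \<Rightarrow> real^'m"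
    and q :: "'l::finite \<Rightarrow> real^'n \<Rightarrow> real"
    and X :: "(real^'n) set"
    and \<rho> \<rho>d c \<nu> \<sigma>1 \<sigma>2 :: real
    and x :: "nat \<Rightarrow> real^'n" and \<mu> :: "nat \<Rightarrow> real^'m"
    and xstar :: "real^'n"
  assumes X_def: "X = {z. \<forall>l. q l z \<le> 0}"
    and X_compact: "compact X"
    and q_C1: "\<forall>l. C1_over UNIV (q l)"
    and gt_cont: "continuous_on X gt"
    and gt_convex: "convex_over X gt"
    and f_C1: "C1_over X f"
    and h_C1: "\<forall>j. C1_over X (\<lambda>z. h z $ j)"
    and params: "\<rho> \<ge> 0" "\<rho>d > 0" "c > 0" "\<nu> > 0"
    and generated: "UDD_ALM f gt h q \<rho> \<rho>d c \<nu> x \<mu>"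
    and xstar_in: "xstar \<in> X"
    and limit_point: "\<exists>r. strict_mono r \<and> (x \<circ> r) \<longlonglongrightarrow> xstar"
    and licq: "LICQ h q xstar"
    and \<sigma>1_def: "\<sigma>1 = min \<nu> \<rho>d"
    and \<sigma>2_def: "\<sigma>2 = c + (\<rho> + \<rho>d) * (SUP z\<in>X. onorm (\<lambda>v. grad_mat h z *v v))"
  shows "KKT f gt h q xstar \<and>
    (let bound = (\<lambda>\<epsilon>::real. \<lceil>(max 1 \<sigma>2)\<^sup>2 *
           (aug_lagrangian f gt h \<rho> (x 0) (\<mu> 0) - f xstar - gt xstar) / (\<sigma>1 * \<epsilon>\<^sup>2)\<rceil>)
     in (\<forall>\<epsilon>>0. \<exists>K::nat. int K \<le> bound \<epsilon> \<and> (\<exists>k\<le>K. eps_KKT f gt h q \<epsilon> (x k))) \<and>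
        (\<lambda>\<epsilon>. real_of_int (bound \<epsilon>)) \<in> O[at_right 0](\<lambda>\<epsilon>. 1 / \<epsilon>\<^sup>2))"
proof -
  have q_C1_X: "C1_over X (q l)" for l
    using q_C1 by (auto simp: C1_over_def intro: continuous_on_subset)
  interpret UDD_ALM_LICQ_limit_point f gt h q X \<rho> \<rho>d c \<nu> x \<mu> xstar
    by unfold_locales (fact X_def q_C1_X gt_cont f_C1 h_C1[rule_format] generated params
        X_compact limit_point licq)+
  have "0 \<le> (SUP z\<in>X. onorm (\<lambda>v. grad_mat h z *v v))"
    using SUP_onorm_grad_mat_nonneg[OF X_compact _ h_C1[rule_format]] xstar_in by blast
  then have "c \<le> \<sigma>2" using params by (simp add: \<sigma>2_def)
  then have M: "1 \<le> max 1 \<sigma>2" "\<bar>c\<bar> \<le> max 1 \<sigma>2" using params by auto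
  have "\<exists>K::nat. int K \<le> \<lceil>(max 1 \<sigma>2)\<^sup>2 *
        (aug_lagrangian f gt h \<rho> (x 0) (\<mu> 0) - f xstar - gt xstar) / (\<sigma>1 * \<epsilon>\<^sup>2)\<rceil> \<and>
      (\<exists>k\<le>K. eps_KKT f gt h q \<epsilon> (x k))" if "0 < \<epsilon>" for \<epsilon>
    using eps_KKT_iteration_bound[OF objective_limit_point_le_merit M that]
    by (simp add: merit_def \<sigma>1_def diff_diff_eq)
  then show ?thesis
    unfolding Let_def using KKT_limit_point ceiling_bigo_inverse_square by blast
qed

end
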